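(* Let $\mathcal{H}$ be a real Hilbert space, let $D\subset\mathcal{H}$ be closed and convex, let $l:\mathcal{H}\to\mathbb{R}$ be lower semicontinuous and convex, and let $f=l+\iota_D$. Assume that $f$ is proper, that $\mathcal{X}=\{z\in\mathcal{H}: f(z)=\min_{x\in\mathcal{H}} f(x)\}$ is nonempty, and put $f_*=\min_{x\in\mathcal{H}} f(x)$. Let $\alpha_1>0$, $\epsilon\geq0$, $\theta\in[0,1)$, and let $\alpha_t=\alpha_1 t^{-\theta}$ and $0\leq\epsilon_t\leq\epsilon\,\alpha_t$ for every $t\in\mathbb{N}^*$. Let $x_1\in\mathcal{H}$ and let $\{x_t\}_{t\in\mathbb{N}^*}$ be generated by $$x_{t+1}=P_D(x_t-\alpha_t g_t)\quad\text{with } g_t\in\partial_{\epsilon_t}l(x_t),\qquad t\in\mathbb{N}^*.$$ Let $B\in\left]0,+\infty\right[$ and assume that $\|g_t\|\leq B$ for every $t\in\mathbb{N}^*$. Then, for every $T\in\mathbb{N}$ with $T>3$, $$f(x_T)-f_*\;\leq\;\frac{d(x_1,\mathcal{X})^2}{2\alpha_1}\,T^{\theta-1}+\alpha_1\,(B^2+2\epsilon)\,c_{2\theta}\,(\log T)^{\mathbf{1}_{\{2\theta\leq1\}}}\,T^{-\min\{\theta,1-\theta\}} .$$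
   Context: $\mathbb{N}^*=\mathbb{N}\setminus\{0\}$; $d(x,S)=\inf_{x'\in S}\|x-x'\|$; $\log$ is the natural logarithm; $\mathbf{1}_{\{2\theta\leq1\}}$ equals $1$ if $2\theta\leq 1$ and $0$ otherwise. $\iota_D$ is the indicator function of $D$ ($0$ on $D$, $+\infty$ outside $D$), and $P_D$ is the metric projection onto $D$. For convex $h:\mathcal{H}\to\left]-\infty,+\infty\right]$ and $\varepsilon\geq0$, $\partial_\varepsilon h(x)=\{u\in\mathcal{H}: \forall y\in\mathcal{H},\ h(x)+\langle u,y-x\rangle-\varepsilon\leq h(y)\}$. The constant is $c_q=5+\frac{2}{1-q}$ if $0\le q<1$, $c_q=9$ if $q=1$, and $c_q=\frac{2^q+3q-1}{q-1}$ if $q>1$. *)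

theory Defs
  imports "HOL-Analysis.Analysis"
begin

definition iota :: "'a set \<Rightarrow> 'a \<Rightarrow> ereal" where
  "iota D x = (if x \<in> D then 0 else \<infinity>)"

definition proper :: "('a \<Rightarrow> ereal) \<Rightarrow> bool" where
  "proper h \<longleftrightarrow> (\<exists>x. h x < \<infinity>) \<and> (\<forall>x. h x > -\<infinity>)"

(* The filter nhds x includes the point x itself. *)
definition lower_semicont :: "('a::topological_space \<Rightarrow> ereal) \<Rightarrow> bool" where
  "lower_semicont h \<longleftrightarrow> (\<forall>x. h x \<le> Liminf (nhds x) h)"

(* The infimum is the minimum exactly when minimizers h is nonempty. *)
definition min_value :: "('a \<Rightarrow> ereal) \<Rightarrow> ereal" where
  "min_value h = (INF x. h x)"

definition minimizers :: "('a \<Rightarrow> ereal) \<Rightarrow> 'a set" where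
  "minimizers h = {z. h z = min_value h}"

definition eps_subdifferential ::
    "real \<Rightarrow> ('a::real_inner \<Rightarrow> ereal) \<Rightarrow> 'a \<Rightarrow> 'a set" where
  "eps_subdifferential \<epsilon> h x = {u. \<forall>y. h x + ereal (u \<bullet> (y - x)) - ereal \<epsilon> \<le> h y}"

(* The library's closest_point requires the class heine_borel, hence finite dimension;
   for D closed, convex and nonempty in a Hilbert space the point selected here
   exists and is unique. *)
definition metric_projection :: "'a::metric_space set \<Rightarrow> 'a \<Rightarrow> 'a" where
  "metric_projection D a = (SOME p. p \<in> D \<and> (\<forall>y\<in>D. dist a p \<le> dist a y))"

(* Only used for q \<ge> 0. *)
definition c_const :: "real \<Rightarrow> real" where
  "c_const q = (if q < 1 then 5 + 2 / (1 - q)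
          else if q = 1 then 9
          else (2 powr q + 3 * q - 1) / (q - 1))"

end

theory Submission
  imports Defs
begin

text \<open>
  Write \<open>M = B\<^sup>2 + 2 * \<epsilon>\<close>, \<open>q = 2 * \<theta>\<close> and \<open>f\<^sub>*\<close> for the minimum of \<open>f\<close>. One projected
  step decreases the squared distance to any point \<open>y\<close> of \<open>D\<close> by \<open>2 * \<alpha> t * (l (x t) - l y)\<close>, up to
  an error \<open>(\<alpha> t)\<^sup>2 * M\<close> (lemma \<open>projected_subgradient_descent\<close>). Summed from \<open>t = 1\<close> with \<open>y\<close> a
  minimizer, this controls a weighted average of the values. Summed from \<open>t = m\<close> with \<open>y = x m\<close>,
  where the initial distance vanishes, it says that the later values exceed \<open>l (x m)\<close> by little on
  average. With \<open>u t = 2 * \<alpha> t * (l (x t) - f\<^sub>*)\<close>, the second family of inequalities lets one pass from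
  the mean of \<open>u m, ..., u T\<close> to the mean of \<open>u (m + 1), ..., u T\<close>, and finally to \<open>u T\<close> itself.
  The errors collected on the way add up exactly to the weights \<open>1 / (T - j)\<close>
  (lemma \<open>last_term_le_of_tail_sums\<close>):
  \<open>u T \<le> d\<^sup>2 / T + M * ((\<alpha> T)\<^sup>2 + (\<Sum>j=1..<T. (\<alpha> j)\<^sup>2 / (T - j)))\<close>.

  This reasoning uses \<open>x 1\<close> as a point of \<open>D\<close> with \<open>l (x 1) \<ge> f\<^sub>*\<close>, while \<open>x 1\<close> is an arbitrary
  point of the space. The remedy is to let \<open>x 2\<close>, which is a projection onto \<open>D\<close>, replace \<open>x 1\<close> in
  the values. The first step then still decreases the squared distance, now by
  \<open>2 * \<alpha> 1 * (l (x 2) - l y)\<close>, at the price of the larger error \<open>4 * (\<alpha> 1)\<^sup>2 * M\<close>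
  (lemma \<open>projected_subgradient_first_step\<close>). Keeping \<open>T\<close> terms rather than starting the sequence
  at \<open>x 2\<close> is what gives the coefficient \<open>1 / T\<close>, and not \<open>1 / (T - 1)\<close>, in front of the squared
  distance.

  It remains to bound \<open>\<Sum>j=1..<T. j powr -q / (T - j)\<close>. For \<open>0 \<le> q \<le> 1\<close>, concavity of the power gives
  \<open>(T / j) powr q \<le> 1 - q + q * T / j\<close>, and partial fractions turn the sum into harmonic sums of size
  \<open>1 + ln T\<close> (lemma \<open>powr_reciprocal_gap_sum_le\<close>). For \<open>1 < q < 2\<close>, the identity
  \<open>T / (T - j) = 1 + j / (T - j)\<close> leaves a convergent series and a sum with exponent \<open>q - 1\<close>, to which
  the first case applies; the logarithm is absorbed by \<open>T powr (q - 1)\<close>.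
\<close>

section \<open>Projection onto a closed convex set\<close>

text \<open>
  By the parallelogram identity and convexity, points of \<open>D\<close> that nearly attain the distance from
  \<open>a\<close> are close to each other, so a minimizing sequence is Cauchy; completeness gives its limit.
\<close>
lemma convex_closed_closest_point_exists:
  fixes D :: "'a::{real_inner, complete_space} set"
  assumes "closed D" "convex D" "D \<noteq> {}"
  shows "\<exists>p\<in>D. \<forall>y\<in>D. dist a p \<le> dist a y"
proof -
  define m where "m = infdist a D"
  have m0: "0 \<le> m" unfolding m_def by (rule infdist_nonneg)
  have mle: "m \<le> dist a y" if "y \<in> D" for y
    unfolding m_def using that by (rule infdist_le)
  have "\<exists>y\<in>D. (dist a y)\<^sup>2 < m\<^sup>2 + 1 / real (Suc n)" for n
  proof -
    have pos: "0 < 1 / real (Suc n)" by simp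
    have "m < sqrt (m\<^sup>2 + 1 / real (Suc n))"
      using m0 pos by (intro real_less_rsqrt) linarith
    then have "(INF y\<in>D. dist a y) < sqrt (m\<^sup>2 + 1 / real (Suc n))"
      using assms(3) by (simp add: m_def infdist_notempty)
    then obtain y where y: "y \<in> D" "dist a y < sqrt (m\<^sup>2 + 1 / real (Suc n))"
      using assms(3) by (auto dest: cInf_lessD[rotated])
    have "(dist a y)\<^sup>2 < (sqrt (m\<^sup>2 + 1 / real (Suc n)))\<^sup>2"
      using y(2) by (intro power_strict_mono) auto
    also have "\<dots> = m\<^sup>2 + 1 / real (Suc n)"
      using pos by (intro real_sqrt_pow2) (simp add: add_nonneg_nonneg)
    finally show ?thesis using y(1) by blast
  qed
  then obtain p where pD: "\<And>n. p n \<in> D"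
    and pm: "\<And>n. (dist a (p n))\<^sup>2 < m\<^sup>2 + 1 / real (Suc n)"
    by metis
  have gap: "(dist (p i) (p j))\<^sup>2 \<le> 2 / real (Suc i) + 2 / real (Suc j)" for i j
  proof -
    \<comment> \<open>The midpoint lies in \<open>D\<close>, hence its distance from \<open>a\<close> is at least \<open>m\<close>.\<close>
    define c where "c = (1/2) *\<^sub>R p i + (1/2) *\<^sub>R p j"
    have "c \<in> D"
      unfolding c_def using pD assms(2) by (intro convexD) auto
    then have "m\<^sup>2 \<le> (dist a c)\<^sup>2"
      using m0 mle by (intro power_mono) auto
    moreover have "(dist (p i) (p j))\<^sup>2
        = 2 * (dist a (p i))\<^sup>2 + 2 * (dist a (p j))\<^sup>2 - 4 * (dist a c)\<^sup>2"
      unfolding dist_norm c_def power2_norm_eq_inner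
      by (simp add: inner_diff_left inner_diff_right inner_add_left inner_add_right
          inner_commute algebra_simps)
    ultimately show ?thesis using pm[of i] pm[of j] by simp
  qed
  have "Cauchy p"
  proof (rule metric_CauchyI)
    fix e :: real assume e: "0 < e"
    obtain N where N: "4 / e\<^sup>2 < real N" using reals_Archimedean2 by blast
    have e2: "0 < e\<^sup>2" using e by simp
    have "dist (p i) (p j) < e" if "i \<ge> N" "j \<ge> N" for i j
    proof -
      have small: "2 / real (Suc k) < e\<^sup>2 / 2" if "k \<ge> N" for k
      proof -
        have "4 / e\<^sup>2 < real (Suc k)" using N that by linarith
        then show ?thesis using e2 by (simp add: field_simps)
      qed
      have "(dist (p i) (p j))\<^sup>2 < e\<^sup>2"
        using gap[of i j] small[OF that(1)] small[OF that(2)] by linarith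
      then show ?thesis using e by (meson power2_less_imp_less less_imp_le)
    qed
    then show "\<exists>M. \<forall>m\<ge>M. \<forall>n\<ge>M. dist (p m) (p n) < e" by blast
  qed
  then obtain q where q: "p \<longlonglongrightarrow> q"
    using Cauchy_convergent_iff convergent_def by blast
  have qD: "q \<in> D" using assms(1) pD q closed_sequentially by blast
  have "(\<lambda>n. (dist a (p n))\<^sup>2) \<longlonglongrightarrow> (dist a q)\<^sup>2"
    using q by (intro tendsto_intros)
  moreover have "(\<lambda>n. m\<^sup>2 + 1 / real (Suc n)) \<longlonglongrightarrow> m\<^sup>2 + 0"
    by (intro tendsto_intros LIMSEQ_Suc[OF lim_1_over_n])
  ultimately have "(dist a q)\<^sup>2 \<le> m\<^sup>2 + 0"
    by (rule LIMSEQ_le) (intro exI[of _ 0] allI impI less_imp_le pm)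
  then have "(dist a q)\<^sup>2 \<le> m\<^sup>2" by simp
  then have "dist a q \<le> m" using m0 by (rule power2_le_imp_le)
  then show ?thesis using qD mle by force
qed

lemma metric_projection_closest:
  fixes D :: "'a::{real_inner, complete_space} set"
  assumes "closed D" "convex D" "D \<noteq> {}"
  shows "metric_projection D a \<in> D \<and> (\<forall>y\<in>D. dist a (metric_projection D a) \<le> dist a y)"
  unfolding metric_projection_def
  using someI_ex[of "\<lambda>p. p \<in> D \<and> (\<forall>y\<in>D. dist a p \<le> dist a y)"]
    convex_closed_closest_point_exists[OF assms, of a] by blast

section \<open>One step of the projected subgradient method\<close>

text \<open>
  The obtuse angle property of the projection \<open>p\<close>. The term \<open>- (norm (p - u))\<^sup>2\<close> is kept because it
  can be large when \<open>u\<close> is far from \<open>D\<close>; the two estimates below spend it in different ways.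
\<close>
lemma projected_step_three_point:
  fixes D :: "'a::{real_inner, complete_space} set" and u v y :: 'a and s :: real
  assumes "closed D" "convex D" "y \<in> D"
  defines "p \<equiv> metric_projection D (u - s *\<^sub>R v)"
  shows "(norm (p - y))\<^sup>2 \<le> (norm (u - y))\<^sup>2 - 2 * s * (v \<bullet> (p - y)) - (norm (p - u))\<^sup>2"
proof -
  have "(u - s *\<^sub>R v - p) \<bullet> (y - p) \<le> 0"
    using metric_projection_closest[OF assms(1,2), of "u - s *\<^sub>R v"] assms(3)
    unfolding p_def by (intro any_closest_point_dot[OF assms(2,1)]) auto
  then show ?thesis
    unfolding power2_norm_eq_inner
    by (simp add: inner_diff_left inner_diff_right inner_commute algebra_simps)
qed

text \<open>
  The function \<open>l\<close> is evaluated at the old point \<open>u\<close>. Moving \<open>v\<close> from \<open>p - y\<close> to \<open>u - y\<close> costs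
  \<open>- 2 * s * (v \<bullet> (p - u))\<close>, which the quadratic term absorbs up to \<open>s\<^sup>2 * (norm v)\<^sup>2\<close>.
\<close>
lemma projected_subgradient_descent:
  fixes D :: "'a::{real_inner, complete_space} set" and u v y :: 'a and s :: real
  assumes "closed D" "convex D" "y \<in> D" "0 \<le> s" "norm v \<le> B"
    and sub: "l u + v \<bullet> (y - u) - e \<le> l y"
  defines "p \<equiv> metric_projection D (u - s *\<^sub>R v)"
  shows "(norm (p - y))\<^sup>2 + 2 * s * (l u - l y) \<le> (norm (u - y))\<^sup>2 + s\<^sup>2 * B\<^sup>2 + 2 * s * e"
proof -
  have "0 \<le> (norm (p - u + s *\<^sub>R v))\<^sup>2" by simp
  then have "- 2 * s * (v \<bullet> (p - u)) - (norm (p - u))\<^sup>2 \<le> s\<^sup>2 * (norm v)\<^sup>2"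
    unfolding power2_norm_eq_inner
    by (simp add: inner_diff_left inner_diff_right inner_add_left inner_add_right
        inner_commute algebra_simps power2_eq_square)
  also have "\<dots> \<le> s\<^sup>2 * B\<^sup>2"
    using assms(5) by (intro mult_left_mono power_mono) auto
  finally have 1: "- 2 * s * (v \<bullet> (p - u)) - (norm (p - u))\<^sup>2 \<le> s\<^sup>2 * B\<^sup>2" .
  have "s * (l u + v \<bullet> (y - u) - e) \<le> s * l y"
    using sub assms(4) by (rule mult_left_mono)
  then have 2: "s * (l u - l y) + s * (v \<bullet> (y - u)) \<le> s * e"
    by (simp add: right_diff_distrib distrib_left)
  have "v \<bullet> (p - y) = v \<bullet> (p - u) - v \<bullet> (y - u)"
    by (simp add: inner_diff_right)
  then have 3: "s * (v \<bullet> (p - y)) = s * (v \<bullet> (p - u)) - s * (v \<bullet> (y - u))"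
    by (simp add: right_diff_distrib)
  show ?thesis
    using 1 2 3 projected_step_three_point[OF assms(1-3), of u s v]
    unfolding p_def[symmetric] by linarith
qed

text \<open>
  Here \<open>l\<close> is evaluated at the new point \<open>p\<close>, which lies in \<open>D\<close> even if \<open>u\<close> does not. The
  approximate subgradient \<open>w\<close> at \<open>p\<close> bounds \<open>l p - l u\<close> by \<open>B * d + e'\<close>, where \<open>d = norm (p - u)\<close>
  may be arbitrarily large. Moving \<open>v\<close> from \<open>u - y\<close> to \<open>p - y\<close> costs another \<open>B * d\<close>, and the resulting
  \<open>4 * s * B * d\<close> is compensated by \<open>- d\<^sup>2\<close>.
\<close>
lemma projected_subgradient_first_step:
  fixes D :: "'a::{real_inner, complete_space} set" and u v w y :: 'a and s :: real
  assumes "closed D" "convex D" "y \<in> D" "0 \<le> s" "norm v \<le> B" "norm w \<le> B"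
  defines "p \<equiv> metric_projection D (u - s *\<^sub>R v)"
  assumes sub: "l u + v \<bullet> (y - u) - e \<le> l y"
    and sub': "l p + w \<bullet> (u - p) - e' \<le> l u"
  shows "(norm (p - y))\<^sup>2 + 2 * s * (l p - l y)
    \<le> (norm (u - y))\<^sup>2 + 4 * s\<^sup>2 * B\<^sup>2 + 2 * s * (e + e')"
proof -
  define d where "d = norm (p - u)"
  have "\<bar>v \<bullet> (p - u)\<bar> \<le> norm v * d" "\<bar>w \<bullet> (u - p)\<bar> \<le> norm w * d"
    using Cauchy_Schwarz_ineq2[of v "p - u"] Cauchy_Schwarz_ineq2[of w "u - p"]
    by (simp_all add: d_def norm_minus_commute)
  moreover have "norm v * d \<le> B * d" "norm w * d \<le> B * d"
    using assms(5,6) by (simp_all add: d_def mult_right_mono)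
  moreover have "v \<bullet> (p - y) = v \<bullet> (p - u) - v \<bullet> (y - u)"
    by (simp add: inner_diff_right)
  ultimately have "l p - l y \<le> v \<bullet> (p - y) + 2 * (B * d) + (e + e')"
    using sub sub' by linarith
  then have "s * (l p - l y) \<le> s * (v \<bullet> (p - y) + 2 * (B * d) + (e + e'))"
    using assms(4) by (rule mult_left_mono)
  then have 1: "s * (l p - l y) \<le> s * (v \<bullet> (p - y)) + 2 * (s * (B * d)) + s * (e + e')"
    by (simp only: distrib_left mult.left_commute)
  have 2: "4 * (s * (B * d)) - d\<^sup>2 \<le> 4 * s\<^sup>2 * B\<^sup>2"
    using zero_le_power2[of "d - 2 * s * B"] by (simp add: power2_eq_square algebra_simps)
  show ?thesis
    using 1 2 projected_step_three_point[OF assms(1-3), of u s v]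
    unfolding p_def[symmetric] d_def[symmetric] by linarith
qed

section \<open>From averages to the last term\<close>

text \<open>
  Let \<open>A m\<close> be the mean of \<open>u j - b j\<close> over \<open>j = m, ..., T\<close>. The tail hypothesis at \<open>m\<close> says precisely
  that \<open>A (m + 1) \<le> A m + b m / (T - m)\<close>. Hence \<open>A T = u T - b T\<close> is at most \<open>A 1\<close> plus the sum of
  these increments, and the first hypothesis bounds \<open>A 1\<close> by \<open>d / T\<close>.
\<close>
lemma last_term_le_of_tail_sums:
  fixes u b :: "nat \<Rightarrow> real"
  assumes "1 \<le> T"
    and mean: "(\<Sum>j=1..T. u j) \<le> d + (\<Sum>j=1..T. b j)"
    and tail: "\<And>m. 1 \<le> m \<Longrightarrow> m < T \<Longrightarrow>
      (\<Sum>j=Suc m..T. u j - u m) \<le> (\<Sum>j=m..T. b j)"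
  shows "u T \<le> d / real T + b T + (\<Sum>j=1..<T. b j / real (T - j))"
proof -
  have "u T \<le> (\<Sum>j=m..T. u j - b j) / real (T + 1 - m) + b T + (\<Sum>j=m..<T. b j / real (T - j))"
    if "m \<le> T" "1 \<le> m" for m
    using that
  proof (induction m rule: inc_induct)
    case base
    then show ?case by simp
  next
    case (step m)
    define k where "k = real (T - m)"
    define S where "S = (\<Sum>j=Suc m..T. u j - b j)"
    have k: "k > 0" "real (T + 1 - Suc m) = k" "real (T + 1 - m) = k + 1"
      using step.hyps by (auto simp: k_def)
    have sums: "(\<Sum>j=m..T. u j - b j) = u m - b m + S"
      "(\<Sum>j=m..<T. b j / real (T - j)) = b m / k + (\<Sum>j=Suc m..<T. b j / real (T - j))"
      using step.hyps by (simp_all add: S_def k_def sum.atLeast_Suc_atMost sum.atLeast_Suc_lessThan)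
    have "(\<Sum>j=Suc m..T. u j) - k * u m \<le> b m + (\<Sum>j=Suc m..T. b j)"
      using tail[of m] step.hyps step.prems
      by (simp add: sum_subtractf k_def sum.atLeast_Suc_atMost[of m T])
    then have S: "S \<le> k * u m + b m" by (simp add: S_def sum_subtractf)
    have "S / k \<le> (u m - b m + S) / (k + 1) + b m / k"
    proof -
      have "0 \<le> (k * u m + b m - S) / (k * (k + 1))"
        using k(1) S by (intro divide_nonneg_pos) auto
      also have "\<dots> = (u m - b m + S) / (k + 1) + b m / k - S / k"
        using k(1) by (simp add: divide_simps) (simp add: algebra_simps)
      finally show ?thesis by simp
    qed
    then show ?case
      using step.IH step.prems unfolding sums k S_def[symmetric] by simp
  qed
  from this[of 1] assms(1)
  have "u T \<le> (\<Sum>j=1..T. u j - b j) / real T + b T + (\<Sum>j=1..<T. b j / real (T - j))"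
    by simp
  also have "(\<Sum>j=1..T. u j - b j) / real T \<le> d / real T"
    using mean by (intro divide_right_mono) (simp_all add: sum_subtractf)
  finally show ?thesis by simp
qed

section \<open>Estimates of the averaging weights\<close>

lemma sum_inverse_le_ln:
  assumes "1 \<le> n"
  shows "(\<Sum>j=1..<n. 1 / real j) \<le> 1 + ln (real n)"
proof -
  have "(\<Sum>j=1..n. 1 / real j) \<le> 1 + ln (real n)"
    using assms
  proof (induction n rule: dec_induct)
    case base
    then show ?case by simp
  next
    case (step n)
    have "ln (real n) - ln (real (Suc n)) \<le> (real n - real (Suc n)) / real (Suc n)"
      using step.hyps by (intro ln_diff_le) auto
    then show ?case using step.IH by (simp add: add.commute)
  qed
  moreover have "(\<Sum>j=1..<n. 1 / real j) \<le> (\<Sum>j=1..n. 1 / real j)"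
    by (intro sum_mono2) auto
  ultimately show ?thesis by linarith
qed

text \<open>
  Concavity of \<open>t \<mapsto> t powr q\<close> bounds \<open>(T / j) powr q\<close> by \<open>1 - q + q * T / j\<close>. After division by
  \<open>T - j\<close>, partial fractions give the summand \<open>1 / (T - j) + q / j\<close>.
\<close>
lemma powr_reciprocal_gap_sum_le:
  assumes "0 \<le> q" "q \<le> 1" "1 \<le> T"
  shows "real T powr q * (\<Sum>j=1..<T. real j powr - q / real (T - j)) \<le> (1 + q) * (1 + ln (real T))"
proof -
  have "real T powr q * (real j powr - q / real (T - j)) \<le> 1 / real (T - j) + q * (1 / real j)"
    if j: "j \<in> {1..<T}" for j
  proof -
    have pos: "0 < real j" "0 < real (T - j)" "real (T - j) = real T - real j"
      using j by auto
    \<comment> \<open>Weighted arithmetic-geometric mean of \<open>T / j\<close> and \<open>1\<close>.\<close>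
    have "(real T / real j) powr q * 1 powr (1 - q) \<le> q * (real T / real j) + (1 - q) * 1"
      using assms(1,2) pos by (intro Youngs_inequality_0) auto
    then have "real T powr q * real j powr - q \<le> q * (real T / real j) + (1 - q)"
      using pos by (simp add: powr_divide powr_minus_divide)
    then have "real T powr q * real j powr - q / real (T - j)
        \<le> (q * (real T / real j) + (1 - q)) / real (T - j)"
      using pos by (intro divide_right_mono) auto
    also have "\<dots> = 1 / real (T - j) + q * (1 / real j)"
      using pos j by (simp add: field_simps)
    finally show ?thesis by simp
  qed
  then have "real T powr q * (\<Sum>j=1..<T. real j powr - q / real (T - j))
      \<le> (\<Sum>j=1..<T. 1 / real (T - j)) + q * (\<Sum>j=1..<T. 1 / real j)"
    unfolding sum_distrib_left sum.distrib[symmetric] by (rule sum_mono)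
  also have "(\<Sum>j=1..<T. 1 / real (T - j)) = (\<Sum>j=1..<T. 1 / real j)"
    by (rule sum.reindex_bij_witness[of _ "\<lambda>j. T - j" "\<lambda>j. T - j"]) auto
  also have "(\<Sum>j=1..<T. 1 / real j) + q * (\<Sum>j=1..<T. 1 / real j) = (1 + q) * (\<Sum>j=1..<T. 1 / real j)"
    by (simp add: algebra_simps)
  also have "\<dots> \<le> (1 + q) * (1 + ln (real T))"
    using sum_inverse_le_ln[OF assms(3)] assms(1) by (intro mult_left_mono) auto
  finally show ?thesis .
qed

text \<open>
  The comparison with an integral in discrete form: the term at \<open>N\<close> is at most
  \<open>((N - 1) powr -p - N powr -p) / p\<close>, by \<open>exp x \<ge> 1 + x\<close> applied to \<open>(N / (N - 1)) powr p\<close>.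
\<close>
lemma sum_powr_le:
  assumes "0 < p" "1 \<le> n"
  shows "(\<Sum>j=1..n. real j powr - (1 + p)) \<le> 1 + (1 - real n powr - p) / p"
  using assms(2)
proof (induction n rule: dec_induct)
  case base
  then show ?case by simp
next
  case (step n)
  define N where "N = real (Suc n)"
  have n: "0 < real n" "real n = N - 1" "1 < N" using step.hyps by (auto simp: N_def)
  have "ln (real n) - ln N \<le> (real n - N) / N"
    using n by (intro ln_diff_le) auto
  then have "1 / N \<le> ln N - ln (real n)" using n by simp
  then have "p * (1 / N) \<le> p * (ln N - ln (real n))"
    using assms(1) by (intro mult_left_mono) auto
  then have "p / N \<le> p * (ln N - ln (real n))" by simp
  then have "1 + p / N \<le> exp (p * (ln N - ln (real n)))"
    using exp_ge_add_one_self[of "p * (ln N - ln (real n))"] by linarith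
  also have "\<dots> = N powr p * real n powr - p"
    using n by (simp add: powr_def algebra_simps flip: exp_add)
  finally have "N powr - p * (1 + p / N) \<le> N powr - p * (N powr p * real n powr - p)"
    by (intro mult_left_mono) auto
  also have "\<dots> = real n powr - p"
    using n by (simp add: mult.assoc[symmetric] flip: powr_add)
  also have "N powr - p * (1 + p / N) = N powr - p + p * N powr - (1 + p)"
    using n by (simp add: powr_minus_divide powr_add powr_diff add_divide_distrib algebra_simps)
  finally have "N powr - (1 + p) \<le> (real n powr - p - N powr - p) / p"
    using assms(1) by (simp add: field_simps)
  then show ?case
    using step.IH unfolding sum.cl_ivl_Suc N_def[symmetric]
    using step.hyps by (simp add: diff_divide_distrib N_def)
qed

lemma one_le_ln:
  assumes "T > (3::nat)"
  shows "1 \<le> ln (real T)"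
  using assms exp_le by (subst ln_ge_iff) auto

text \<open>
  The left-hand side is the total weight that \<open>last_term_le_of_tail_sums\<close> produces from
  \<open>b j = j powr -q\<close> for \<open>j \<ge> 2\<close> and \<open>b 1 = 4\<close>. The summand \<open>3 / (T - 1)\<close> is the excess of \<open>b 1\<close> over
  \<open>1\<close>; it is harmless since \<open>3 * T \<le> 4 * (T - 1)\<close> for \<open>T > 3\<close>.
\<close>
lemma averaging_weight_le_small_exponent:
  assumes "0 \<le> q" "q \<le> 1" "T > 3"
  shows "real T powr - q + 3 / (real T - 1) + (\<Sum>j=1..<T. real j powr - q / real (T - j))
    \<le> 2 * c_const q * ln (real T) * real T powr - q" (is "?K \<le> _")
proof -
  define L where "L = ln (real T)"
  have L: "1 \<le> L" unfolding L_def using assms(3) by (rule one_le_ln)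
  have T: "3 < real T" using assms(3) by simp
  have "real T powr q \<le> real T powr 1" using assms T by (intro powr_mono) auto
  then have "real T powr q * (3 / (real T - 1)) \<le> real T * (3 / (real T - 1))"
    using T by (intro mult_right_mono) auto
  also have "\<dots> \<le> 4" using assms(3) by (simp add: field_simps)
  finally have 1: "real T powr q * (3 / (real T - 1)) \<le> 4" .
  have "real T powr q * (\<Sum>j=1..<T. real j powr - q / real (T - j)) \<le> (1 + q) * (1 + L)"
    unfolding L_def using assms by (intro powr_reciprocal_gap_sum_le) auto
  also have "\<dots> \<le> 2 * (1 + L)" using assms L by (intro mult_right_mono) auto
  finally have 2: "real T powr q * (\<Sum>j=1..<T. real j powr - q / real (T - j)) \<le> 2 * (1 + L)" .
  have one: "real T powr q * real T powr - q = 1" using T by (simp flip: powr_add)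
  have c: "5 \<le> c_const q" using assms by (auto simp: c_const_def)
  have "real T powr q * ?K = 1 + real T powr q * (3 / (real T - 1))
      + real T powr q * (\<Sum>j=1..<T. real j powr - q / real (T - j))"
    by (simp only: distrib_left one)
  also have "\<dots> \<le> 1 + 4 + 2 * (1 + L)"
    by (intro add_mono 1 2 order_refl)
  also have "\<dots> \<le> 10 * L" using L by simp
  also have "\<dots> \<le> 2 * c_const q * L" using c L by (intro mult_right_mono) auto
  finally have "real T powr - q * (real T powr q * ?K) \<le> real T powr - q * (2 * c_const q * L)"
    by (intro mult_left_mono) auto
  moreover have "real T powr - q * (real T powr q * ?K) = ?K"
    unfolding mult.assoc[symmetric] mult.commute[of _ "real T powr q"] one by simp
  moreover have "real T powr - q * (2 * c_const q * L) = 2 * c_const q * L * real T powr - q"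
    by (rule mult.commute)
  ultimately show ?thesis unfolding L_def[symmetric] by (simp only:)
qed

text \<open>
  After multiplication by \<open>T\<close>, the identity \<open>T / (T - j) = 1 + j / (T - j)\<close> splits the sum into a
  convergent series with exponent \<open>1 + p\<close> and a sum with exponent \<open>p = q - 1\<close>. The second one is at
  most \<open>(1 + p) * (1 + ln T) / T powr p\<close>, and \<open>T powr p \<ge> 1 + p * ln T\<close> removes the logarithm. Each
  part contributes at most \<open>1 + 1 / p\<close>.
\<close>
lemma averaging_weight_le_large_exponent:
  assumes "1 < q" "q \<le> 2" "T > 3"
  shows "real T powr - q + 3 / (real T - 1) + (\<Sum>j=1..<T. real j powr - q / real (T - j))
    \<le> 2 * c_const q / real T" (is "?K \<le> _")
proof -
  define p where "p = q - 1"
  define L where "L = ln (real T)"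
  have p: "0 < p" "p \<le> 1" "q = 1 + p" using assms by (auto simp: p_def)
  have L: "1 \<le> L" unfolding L_def using assms(3) by (rule one_le_ln)
  have T: "3 < real T" using assms(3) by simp
  have Tp: "1 + p * L \<le> real T powr p"
    using exp_ge_add_one_self[of "p * L"] T by (simp add: powr_def L_def)
  have split: "real T * (real j powr - q / real (T - j))
      = real j powr - (1 + p) + real j powr - p / real (T - j)" if "j \<in> {1..<T}" for j
  proof -
    define r where "r = real (T - j)"
    have pos: "0 < real j" "0 < r" "real T = r + real j" using that by (auto simp: r_def)
    have "real j powr - q * real j = real j powr - p"
      using pos(1) p(3) powr_add[of "real j" "- q" 1] by simp
    then show ?thesis
      unfolding r_def[symmetric] pos(3) p(3)[symmetric]
      using pos(2) by (simp add: field_simps)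
  qed
  have "(\<Sum>j=1..<T. real j powr - (1 + p)) \<le> (\<Sum>j=1..T. real j powr - (1 + p))"
    by (intro sum_mono2) auto
  also have "\<dots> \<le> 1 + (1 - real T powr - p) / p"
    using p(1) T by (intro sum_powr_le) auto
  also have "\<dots> \<le> 1 + 1 / p" using p(1) by (intro add_left_mono divide_right_mono) auto
  finally have 1: "(\<Sum>j=1..<T. real j powr - (1 + p)) \<le> 1 + 1 / p" .
  have 2: "(\<Sum>j=1..<T. real j powr - p / real (T - j)) \<le> 1 + 1 / p" (is "?S \<le> _")
  proof -
    have S0: "0 \<le> ?S" by (intro sum_nonneg) auto
    have "(1 + p * L) * ?S \<le> real T powr p * ?S"
      using Tp S0 by (rule mult_right_mono)
    also have "\<dots> \<le> (1 + p) * (1 + L)"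
      unfolding L_def using p T by (intro powr_reciprocal_gap_sum_le) auto
    also have "\<dots> = (1 + 1 / p) * (p + p * L)" using p by (simp add: field_simps)
    also have "\<dots> \<le> (1 + 1 / p) * (1 + p * L)" using p by (intro mult_left_mono) auto
    finally have "(1 + p * L) * ?S \<le> (1 + p * L) * (1 + 1 / p)" by (simp only: mult.commute)
    moreover have "0 < 1 + p * L" using p L by (simp add: add_pos_nonneg)
    ultimately show ?thesis by (simp only: mult_le_cancel_left_pos)
  qed
  have "real T * real T powr - q = real T powr - p"
    using T p(3) powr_add[of "real T" 1 "- q"] by simp
  also have "\<dots> \<le> 1" using T p(1) by (simp add: powr_le_one_le powr_minus_divide ge_one_powr_ge_zero)
  finally have 3: "real T * real T powr - q \<le> 1" .
  have 4: "real T * (3 / (real T - 1)) \<le> 4" using assms(3) by (simp add: field_simps)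
  have "real T * (\<Sum>j=1..<T. real j powr - q / real (T - j))
      = (\<Sum>j=1..<T. real j powr - (1 + p) + real j powr - p / real (T - j))"
    unfolding sum_distrib_left by (intro sum.cong refl split)
  then have "real T * ?K \<le> 5 + (1 + 1 / p) + (1 + 1 / p)"
    unfolding distrib_left using 1 2 3 4 by (simp add: sum.distrib)
  also have "\<dots> \<le> 2 * c_const q"
  proof -
    have "c_const q = (2 powr q + 3 * q - 1) / p"
      using assms by (simp add: c_const_def p_def)
    moreover have "1 \<le> 2 powr q" using assms by (simp add: ge_one_powr_ge_zero)
    ultimately have "(7 * p + 2) / p \<le> 2 * c_const q"
      using p by (simp add: divide_right_mono)
    moreover have "5 + (1 + 1 / p) + (1 + 1 / p) = (7 * p + 2) / p"
      using p(1) by (simp add: field_simps)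
    ultimately show ?thesis by simp
  qed
  finally show ?thesis using T by (simp add: field_simps)
qed

section \<open>Rate of convergence of the last iterate\<close>

theorem theorem3p4:
  fixes D :: "'a::{real_inner, complete_space} set"
    and l :: "'a \<Rightarrow> real"
    and f :: "'a \<Rightarrow> ereal"
    and \<alpha> \<epsilon>s :: "nat \<Rightarrow> real"
    and \<epsilon> \<theta> B :: real
    and x g :: "nat \<Rightarrow> 'a"
    and T :: nat
  assumes "closed D" and "convex D"
    and "lower_semicont (\<lambda>z. ereal (l z))" and "convex_on UNIV l"
    and "f = (\<lambda>z. ereal (l z) + iota D z)"
    and "proper f"
    and "minimizers f \<noteq> {}"
    and "\<alpha> 1 > 0" and "\<epsilon> \<ge> 0" and "0 \<le> \<theta>" and "\<theta> < 1"
    and "\<And>t. t \<ge> 1 \<Longrightarrow> \<alpha> t = \<alpha> 1 * real t powr (- \<theta>)"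
    and "\<And>t. t \<ge> 1 \<Longrightarrow> 0 \<le> \<epsilon>s t \<and> \<epsilon>s t \<le> \<epsilon> * \<alpha> t"
    and "\<And>t. t \<ge> 1 \<Longrightarrow> g t \<in> eps_subdifferential (\<epsilon>s t) (\<lambda>z. ereal (l z)) (x t)"
    and "\<And>t. t \<ge> 1 \<Longrightarrow> x (t + 1) = metric_projection D (x t - \<alpha> t *\<^sub>R g t)"
    and "B > 0"
    and "\<And>t. t \<ge> 1 \<Longrightarrow> norm (g t) \<le> B"
    and "T > 3"
  shows "f (x T) - min_value f
    \<le> ereal ((infdist (x 1) (minimizers f))\<^sup>2 / (2 * \<alpha> 1) * real T powr (\<theta> - 1)
        + \<alpha> 1 * (B\<^sup>2 + 2 * \<epsilon>) * c_const (2 * \<theta>)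
            * (ln (real T)) ^ (if 2 * \<theta> \<le> 1 then 1 else 0)
            * real T powr (- min \<theta> (1 - \<theta>)))"
proof -
  note clD = assms(1) and cvD = assms(2) and f = assms(5)
  define S where "S = minimizers f"
  define M where "M = B\<^sup>2 + 2 * \<epsilon>"
  \<comment> \<open>The factor 4 is the price of evaluating \<open>l\<close> at \<open>x 2\<close> instead of \<open>x 1\<close> in the first step.\<close>
  define b where "b j = (if j = 1 then 4 else 1) * ((\<alpha> j)\<^sup>2 * M)" for j
  have M0: "0 \<le> M" using assms(9) by (simp add: M_def)
  have fin: "f z = ereal (l z)" if "z \<in> D" for z
    using that by (simp add: f iota_def)
  have inf: "f z = \<infinity>" if "z \<notin> D" for z
    using that by (simp add: f iota_def)
  obtain z0 where "f z0 < \<infinity>" using assms(6) by (auto simp: proper_def)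
  then have z0: "z0 \<in> D" using inf by fastforce
  then have D: "D \<noteq> {}" by blast
  have min_le: "min_value f \<le> f z" for z
    unfolding min_value_def by (simp add: INF_lower)
  obtain w where w: "w \<in> S" using assms(7) unfolding S_def by blast
  have SD: "z \<in> D \<and> min_value f = ereal (l z)" if "z \<in> S" for z
  proof -
    have eq: "f z = min_value f" using that by (simp add: S_def minimizers_def)
    have "f z \<noteq> \<infinity>" using min_le[of z0] fin[OF z0] unfolding eq by auto
    then have "z \<in> D" using inf by blast
    then show ?thesis using eq fin by simp
  qed
  have lmin: "l z \<le> l y" if "z \<in> S" "y \<in> D" for z y
    using SD[OF that(1)] min_le[of y] fin[OF that(2)] by simp
  have xD: "x j \<in> D" if "2 \<le> j" for j
  proof -
    have "x (j - 1 + 1) \<in> D"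
      using that assms(15)[of "j - 1"] metric_projection_closest[OF clD cvD D] by simp
    then show ?thesis using that by simp
  qed
  have \<alpha>_pos: "0 < \<alpha> j" if "1 \<le> j" for j
    using assms(12)[OF that] assms(8) that by simp
  have \<alpha>_mono: "\<alpha> j \<le> \<alpha> i" if "1 \<le> i" "i \<le> j" for i j
    unfolding assms(12)[OF that(1)] assms(12)[OF order_trans[OF that]]
    using that assms(8,10) by (intro mult_left_mono powr_mono2') auto
  have sub: "l (x j) + g j \<bullet> (y - x j) - \<epsilon>s j \<le> l y" if "1 \<le> j" for j y
    using assms(14)[OF that] by (simp add: eps_subdifferential_def)
  have \<epsilon>s_le: "\<epsilon>s j \<le> \<epsilon> * \<alpha> j" if "1 \<le> j" for j
    using assms(13)[OF that] by simp
  have descent: "(norm (x (Suc j) - y))\<^sup>2 + 2 * \<alpha> j * (l (x j) - l y)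
      \<le> (norm (x j - y))\<^sup>2 + (\<alpha> j)\<^sup>2 * M" if "1 \<le> j" "y \<in> D" for j y
  proof -
    have "2 * \<alpha> j * \<epsilon>s j \<le> 2 * \<alpha> j * (\<epsilon> * \<alpha> j)"
      using \<alpha>_pos[OF that(1)] \<epsilon>s_le[OF that(1)] by (intro mult_left_mono) auto
    moreover have "x (Suc j) = metric_projection D (x j - \<alpha> j *\<^sub>R g j)"
      using assms(15)[OF that(1)] by simp
    then have "(norm (x (Suc j) - y))\<^sup>2 + 2 * \<alpha> j * (l (x j) - l y)
        \<le> (norm (x j - y))\<^sup>2 + (\<alpha> j)\<^sup>2 * B\<^sup>2 + 2 * \<alpha> j * \<epsilon>s j"
      using projected_subgradient_descent[OF clD cvD that(2) _ assms(17)[OF that(1)]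
          sub[OF that(1)], of "\<alpha> j"] \<alpha>_pos[OF that(1)] by simp
    moreover have "(\<alpha> j)\<^sup>2 * M = (\<alpha> j)\<^sup>2 * B\<^sup>2 + 2 * \<alpha> j * (\<epsilon> * \<alpha> j)"
      by (simp add: M_def algebra_simps power2_eq_square)
    ultimately show ?thesis by linarith
  qed
  have telescope: "(\<Sum>j=n..N. 2 * \<alpha> j * (l (x j) - l y))
      \<le> (norm (x n - y))\<^sup>2 + (\<Sum>j=n..N. (\<alpha> j)\<^sup>2 * M)"
    if "1 \<le> n" "n \<le> Suc N" "y \<in> D" for n N y
  proof -
    have "(\<Sum>j=n..N. 2 * \<alpha> j * (l (x j) - l y))
        \<le> (\<Sum>j=n..N. (\<alpha> j)\<^sup>2 * M - ((norm (x (Suc j) - y))\<^sup>2 - (norm (x j - y))\<^sup>2))"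
    proof (rule sum_mono)
      fix j assume "j \<in> {n..N}"
      then show "2 * \<alpha> j * (l (x j) - l y)
          \<le> (\<alpha> j)\<^sup>2 * M - ((norm (x (Suc j) - y))\<^sup>2 - (norm (x j - y))\<^sup>2)"
        using descent[of j y] that by simp
    qed
    also have "\<dots> = (\<Sum>j=n..N. (\<alpha> j)\<^sup>2 * M) - ((norm (x (Suc N) - y))\<^sup>2 - (norm (x n - y))\<^sup>2)"
      using that(2) sum_Suc_diff[of n N "\<lambda>j. (norm (x j - y))\<^sup>2"] by (simp add: sum_subtractf)
    finally show ?thesis using zero_le_power2[of "norm (x (Suc N) - y)"] by linarith
  qed
  have first: "(norm (x 2 - z))\<^sup>2 + 2 * \<alpha> 1 * (l (x 2) - l z) \<le> (norm (x 1 - z))\<^sup>2 + b 1"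
    if "z \<in> D" for z
  proof -
    have x2: "x 2 = metric_projection D (x 1 - \<alpha> 1 *\<^sub>R g 1)"
      using assms(15)[of 1] by (simp add: numeral_2_eq_2)
    have "\<epsilon> * \<alpha> 2 \<le> \<epsilon> * \<alpha> 1" using \<alpha>_mono[of 1 2] assms(9) by (intro mult_left_mono) auto
    then have "\<epsilon>s 1 + \<epsilon>s 2 \<le> 2 * (\<epsilon> * \<alpha> 1)" using \<epsilon>s_le[of 1] \<epsilon>s_le[of 2] by simp
    then have "2 * \<alpha> 1 * (\<epsilon>s 1 + \<epsilon>s 2) \<le> 2 * \<alpha> 1 * (2 * (\<epsilon> * \<alpha> 1))"
      using assms(8) by (intro mult_left_mono) auto
    also have "\<dots> \<le> 8 * (\<alpha> 1)\<^sup>2 * \<epsilon>"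
      using assms(8,9) by (simp add: power2_eq_square algebra_simps)
    finally have "4 * (\<alpha> 1)\<^sup>2 * B\<^sup>2 + 2 * \<alpha> 1 * (\<epsilon>s 1 + \<epsilon>s 2) \<le> b 1"
      by (simp add: b_def M_def algebra_simps)
    moreover have "(norm (x 2 - z))\<^sup>2 + 2 * \<alpha> 1 * (l (x 2) - l z)
        \<le> (norm (x 1 - z))\<^sup>2 + 4 * (\<alpha> 1)\<^sup>2 * B\<^sup>2 + 2 * \<alpha> 1 * (\<epsilon>s 1 + \<epsilon>s 2)"
      unfolding x2
      using assms(8) that sub[of 1 z] sub[of 2 "x 1"] assms(17)[of 1] assms(17)[of 2]
      by (intro projected_subgradient_first_step[OF clD cvD, where w = "g 2"]) (auto simp: x2)
    ultimately show ?thesis by linarith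
  qed
  \<comment> \<open>The sum of the weighted errors, in units of \<open>(\<alpha> 1)\<^sup>2 * M\<close>.\<close>
  define W where "W = real T powr - (2 * \<theta>) + 3 / (real T - 1)
    + (\<Sum>j=1..<T. real j powr - (2 * \<theta>) / real (T - j))"
  have main: "2 * \<alpha> T * (l (x T) - l w) \<le> (dist (x 1) z)\<^sup>2 / real T + (\<alpha> 1)\<^sup>2 * M * W"
    if z: "z \<in> S" for z
  proof -
    \<comment> \<open>The index 1 is redirected to 2, so that every point \<open>x (r j)\<close> lies in \<open>D\<close>.\<close>
    define r where "r j = max 2 j" for j :: nat
    define u where "u j = 2 * \<alpha> j * (l (x (r j)) - l z)" for j
    have zD: "z \<in> D" using SD[OF z] by blast
    have bge: "(\<alpha> j)\<^sup>2 * M \<le> b j" for j using M0 by (simp add: b_def)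
    have b0: "0 \<le> b j" for j using M0 by (simp add: b_def)
    have "u T \<le> (dist (x 1) z)\<^sup>2 / real T + b T + (\<Sum>j=1..<T. b j / real (T - j))"
    proof (rule last_term_le_of_tail_sums)
      show "1 \<le> T" using assms(18) by simp
    next
      have "(\<Sum>j=2..T. u j) = (\<Sum>j=2..T. 2 * \<alpha> j * (l (x j) - l z))"
        by (intro sum.cong) (auto simp: u_def r_def)
      also have "\<dots> \<le> (norm (x 2 - z))\<^sup>2 + (\<Sum>j=2..T. (\<alpha> j)\<^sup>2 * M)"
        using assms(18) zD by (intro telescope) auto
      also have "(\<Sum>j=2..T. (\<alpha> j)\<^sup>2 * M) = (\<Sum>j=2..T. b j)"
        by (intro sum.cong) (auto simp: b_def)
      finally have "(\<Sum>j=2..T. u j) \<le> (norm (x 2 - z))\<^sup>2 + (\<Sum>j=2..T. b j)" .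
      moreover have split_first: "(\<Sum>j=1..T. h j) = h 1 + (\<Sum>j=2..T. h j)" for h :: "nat \<Rightarrow> real"
        using sum.atLeast_Suc_atMost[of 1 T h] assms(18) by (simp add: numeral_2_eq_2)
      moreover have "u 1 = 2 * \<alpha> 1 * (l (x 2) - l z)" by (simp add: u_def r_def numeral_2_eq_2)
      ultimately show "(\<Sum>j=1..T. u j) \<le> (dist (x 1) z)\<^sup>2 + (\<Sum>j=1..T. b j)"
        using first[OF zD] split_first[of u] split_first[of b] unfolding dist_norm by linarith
    next
      fix m assume m: "1 \<le> m" "m < T"
      have rD: "x (r m) \<in> D" by (rule xD) (simp add: r_def)
      have lw: "l z \<le> l (x (r m))" using lmin[OF z rD] .
      have "(\<Sum>j=Suc m..T. u j - u m) \<le> (\<Sum>j=Suc m..T. 2 * \<alpha> j * (l (x j) - l (x (r m))))"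
      proof (rule sum_mono)
        fix j assume j: "j \<in> {Suc m..T}"
        \<comment> \<open>The decrease of the step sizes has the right sign because \<open>l (x (r m))\<close> is above the minimum.\<close>
        have "\<alpha> j * (l (x (r m)) - l z) \<le> \<alpha> m * (l (x (r m)) - l z)"
          using \<alpha>_mono[of m j] m j lw by (intro mult_right_mono) auto
        moreover have "r j = j" using j m by (simp add: r_def)
        ultimately show "u j - u m \<le> 2 * \<alpha> j * (l (x j) - l (x (r m)))"
          by (simp add: u_def algebra_simps)
      qed
      also have "\<dots> = (\<Sum>j=r m..T. 2 * \<alpha> j * (l (x j) - l (x (r m))))"
      proof (rule sum.mono_neutral_left)
        show "{Suc m..T} \<subseteq> {r m..T}" using m by (auto simp: r_def)
        have "i = r m" if "i \<in> {r m..T} - {Suc m..T}" for i using that m by (auto simp: r_def)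
        then show "\<forall>i\<in>{r m..T} - {Suc m..T}. 2 * \<alpha> i * (l (x i) - l (x (r m))) = 0" by force
      qed simp
      also have "\<dots> \<le> (norm (x (r m) - x (r m)))\<^sup>2 + (\<Sum>j=r m..T. (\<alpha> j)\<^sup>2 * M)"
        using m rD by (intro telescope) (auto simp: r_def)
      also have "\<dots> \<le> (\<Sum>j=r m..T. b j)" using bge by (simp add: sum_mono)
      also have "\<dots> \<le> (\<Sum>j=m..T. b j)"
        using b0 by (intro sum_mono2) (auto simp: r_def)
      finally show "(\<Sum>j=Suc m..T. u j - u m) \<le> (\<Sum>j=m..T. b j)" .
    qed
    moreover have "b T + (\<Sum>j=1..<T. b j / real (T - j)) = (\<alpha> 1)\<^sup>2 * M * W"
    proof -
      have a2: "(\<alpha> j)\<^sup>2 * M = (\<alpha> 1)\<^sup>2 * M * real j powr - (2 * \<theta>)" if "1 \<le> j" for j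
      proof -
        have "(real j powr - \<theta>)\<^sup>2 = real j powr - (2 * \<theta>)"
          using powr_add[of "real j" "- \<theta>" "- \<theta>"] by (simp add: power2_eq_square)
        then show ?thesis
          unfolding assms(12)[OF that] by (simp add: power_mult_distrib)
      qed
      have "b j / real (T - j) = (\<alpha> 1)\<^sup>2 * M * (real j powr - (2 * \<theta>) / real (T - j))
          + (if j = 1 then (\<alpha> 1)\<^sup>2 * M * (3 / (real T - 1)) else 0)" if "j \<in> {1..<T}" for j
        using that a2[of j] by (auto simp: b_def of_nat_diff add_divide_distrib[symmetric])
      then have "(\<Sum>j=1..<T. b j / real (T - j))
          = (\<Sum>j=1..<T. (\<alpha> 1)\<^sup>2 * M * (real j powr - (2 * \<theta>) / real (T - j))
            + (if j = 1 then (\<alpha> 1)\<^sup>2 * M * (3 / (real T - 1)) else 0))"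
        by (rule sum.cong[OF refl])
      also have "\<dots> = (\<alpha> 1)\<^sup>2 * M * (\<Sum>j=1..<T. real j powr - (2 * \<theta>) / real (T - j))
            + (\<alpha> 1)\<^sup>2 * M * (3 / (real T - 1))"
        unfolding sum.distrib sum_distrib_left[symmetric] using assms(18) by simp
      finally have "(\<Sum>j=1..<T. b j / real (T - j))
          = (\<alpha> 1)\<^sup>2 * M * (\<Sum>j=1..<T. real j powr - (2 * \<theta>) / real (T - j))
            + (\<alpha> 1)\<^sup>2 * M * (3 / (real T - 1))" .
      moreover have "b T = (\<alpha> 1)\<^sup>2 * M * real T powr - (2 * \<theta>)"
        using a2[of T] assms(18) by (simp add: b_def)
      ultimately show ?thesis unfolding W_def distrib_left by linarith
    qed
    moreover have "u T = 2 * \<alpha> T * (l (x T) - l w)"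
      using assms(18) SD[OF z] SD[OF w] by (simp add: u_def r_def)
    ultimately show ?thesis by simp
  qed
  have T: "3 < real T" using assms(18) by simp
  define d where "d = infdist (x 1) S"
  \<comment> \<open>\<open>main\<close> says \<open>K \<le> (dist (x 1) z)\<^sup>2\<close> for every minimizer \<open>z\<close>. Taking square roots, which needs
    the positive part of \<open>K\<close>, carries the bound over to the infimum of the distances.\<close>
  define K where "K = real T * (2 * \<alpha> T * (l (x T) - l w) - (\<alpha> 1)\<^sup>2 * M * W)"
  have "K \<le> d\<^sup>2"
  proof -
    have "sqrt (max 0 K) \<le> dist (x 1) z" if "z \<in> S" for z
    proof (rule real_le_lsqrt)
      show "max 0 K \<le> (dist (x 1) z)\<^sup>2"
        using main[OF that] T by (simp add: K_def field_simps)
    qed auto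
    then have "sqrt (max 0 K) \<le> d"
      using w unfolding d_def by (subst infdist_notempty) (auto intro: cINF_greatest)
    then have "max 0 K \<le> d\<^sup>2" by (rule sqrt_le_D)
    then show ?thesis by simp
  qed
  then have best: "2 * \<alpha> T * (l (x T) - l w) \<le> d\<^sup>2 / real T + (\<alpha> 1)\<^sup>2 * M * W"
    using T by (simp add: K_def field_simps)
  define R where "R = c_const (2 * \<theta>) * (ln (real T)) ^ (if 2 * \<theta> \<le> 1 then 1 else 0)
    * real T powr (- min \<theta> (1 - \<theta>))"
  have WR: "real T powr \<theta> * W \<le> 2 * R"
  proof (cases "2 * \<theta> \<le> 1")
    case True
    have "W \<le> 2 * c_const (2 * \<theta>) * ln (real T) * real T powr - (2 * \<theta>)"
      unfolding W_def using True assms(10,18) by (intro averaging_weight_le_small_exponent) auto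
    then have "real T powr \<theta> * W
        \<le> real T powr \<theta> * (2 * c_const (2 * \<theta>) * ln (real T) * real T powr - (2 * \<theta>))"
      by (intro mult_left_mono) auto
    also have "\<dots> = 2 * c_const (2 * \<theta>) * ln (real T) * real T powr (\<theta> + - (2 * \<theta>))"
      unfolding powr_add by simp
    also have "\<dots> = 2 * R" using True by (simp add: R_def min_def)
    finally show ?thesis .
  next
    case False
    have "W \<le> 2 * c_const (2 * \<theta>) / real T"
      unfolding W_def using False assms(11,18) by (intro averaging_weight_le_large_exponent) auto
    then have "real T powr \<theta> * W \<le> real T powr \<theta> * (2 * c_const (2 * \<theta>) / real T)"
      by (intro mult_left_mono) auto
    also have "\<dots> = 2 * c_const (2 * \<theta>) * real T powr (\<theta> - 1)"
      using T by (simp add: powr_diff)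
    also have "\<dots> = 2 * R" using False by (simp add: R_def min_def)
    finally show ?thesis .
  qed
  have aT: "2 * \<alpha> T = 2 * \<alpha> 1 / real T powr \<theta>"
    using assms(12)[of T] T by (simp add: powr_minus_divide)
  have "l (x T) - l w \<le> (d\<^sup>2 / real T + (\<alpha> 1)\<^sup>2 * M * W) * real T powr \<theta> / (2 * \<alpha> 1)"
    using best T assms(8) unfolding aT by (simp add: field_simps)
  also have "\<dots> = d\<^sup>2 / (2 * \<alpha> 1) * real T powr (\<theta> - 1) + \<alpha> 1 * M / 2 * (real T powr \<theta> * W)"
    using assms(8) T by (simp add: powr_diff field_simps power2_eq_square)
  also have "\<dots> \<le> d\<^sup>2 / (2 * \<alpha> 1) * real T powr (\<theta> - 1) + \<alpha> 1 * M / 2 * (2 * R)"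
    using WR assms(8) M0 by (intro add_left_mono mult_left_mono) auto
  finally have "l (x T) - l w
      \<le> d\<^sup>2 / (2 * \<alpha> 1) * real T powr (\<theta> - 1) + \<alpha> 1 * M * R" by simp
  moreover have "f (x T) - min_value f = ereal (l (x T) - l w)"
    using fin[OF xD[of T]] assms(18) SD[OF w] by simp
  ultimately show ?thesis
    unfolding d_def S_def M_def R_def by (simp add: mult.assoc)
qed

end
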